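(* Let $U\subseteq\mathbb{R}^N$ be open and connected and let $\mathcal{F}$ be a real vector space (under pointwise operations) of functions $F:U\to\mathbb{R}^M$, all of which are real analytic (in particular, $\mathcal{F}$ may consist entirely of linear functions, or entirely of polynomial functions). Then $\mathcal{F}$ is ACR.
   Context: $DF(x)$ is the $M\times N$ Jacobian matrix of $F$ at $x$. $\operatorname{maxrank}(\mathcal{F})=\max_{F\in\mathcal{F},\,x\in U}\operatorname{rank}(DF(x))$. The vector space $\mathcal{F}$ has almost constant rank (is ACR) if for almost every $F\in\mathcal{F}$ and Lebesgue almost every $x\in U$, $\operatorname{rank}(DF(x))=\operatorname{maxrank}(\mathcal{F})$. "Almost every $F\in\mathcal{F}$": if $\mathcal{F}$ is finite-dimensional, this is with respect to Lebesgue measure on $\mathcal{F}$. If $\mathcal{F}$ is infinite-dimensional, it is in the sense of prevalence: a set $G\subseteq\mathcal{F}$ is called measurable if $Z\cap G$ is Lebesgue measurable in $Z$ for every finite-dimensional plane (affine subspace) $Z\subseteq\mathcal{F}$; almost every element of $\mathcal{F}$ is in a measurable set $G$ if there is a finite-dimensional linear subspace $X\subseteq\mathcal{F}$ such that for every $P\in\mathcal{F}$ and Lebesgue almost every $H\in X$ one has $H+P\in G$. A property holds for almost every $F\in\mathcal{F}$ if it holds for all $F$ in some such measurable $G$. *)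

theory Defs
  imports "HOL-Analysis.Analysis" "HOL-Library.Function_Algebras"
begin

section \<open>Functions as a real vector space\<close>

instantiation "fun" :: (type, real_vector) real_vector
begin

definition scaleR_fun_def: "c *\<^sub>R f = (\<lambda>x. c *\<^sub>R f x)"

instance
  by standard
    (auto simp: scaleR_fun_def fun_eq_iff plus_fun_def scaleR_add_right scaleR_add_left)

end

section \<open>Real analytic maps of several variables\<close>

text \<open>
  Local expansion into a power series indexed by multi-indices. Unordered summation (\<^const>\<open>has_sum\<close>)
  in a finite-dimensional space is absolute convergence.
\<close>

definition real_analytic_on :: "(real^'n \<Rightarrow> real^'m) \<Rightarrow> (real^'n) set \<Rightarrow> bool"
    (infixl "(real'_analytic'_on)" 50) where
  "f real_analytic_on U \<longleftrightarrow>
     (\<forall>a\<in>U. \<exists>r>0. \<exists>c :: ('n \<Rightarrow> nat) \<Rightarrow> real^'m. ball a r \<subseteq> U \<and>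
        (\<forall>x\<in>ball a r.
          ((\<lambda>\<alpha>. (\<Prod>i\<in>UNIV. (x $ i - a $ i) ^ \<alpha> i) *\<^sub>R c \<alpha>) has_sum f x) UNIV))"

section \<open>Real vector spaces of functions on a domain\<close>

text \<open>
  A function \<open>U \<rightarrow> \<real>\<^sup>M\<close> is represented by its extension by \<open>0\<close> outside \<open>U\<close>. On such
  representatives equality of total functions is equality on \<open>U\<close>, and the vector space operations
  are the pointwise ones, so dimension and linear independence are those of the functions on \<open>U\<close>.
\<close>

definition function_space_on ::
    "(real^'n) set \<Rightarrow> (real^'n \<Rightarrow> real^'m) set \<Rightarrow> bool" where
  "function_space_on U \<F> \<longleftrightarrow> subspace \<F> \<and> (\<forall>F\<in>\<F>. \<forall>x. x \<notin> U \<longrightarrow> F x = 0)"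

section \<open>Lebesgue measure on finite-dimensional planes\<close>

text \<open>
  For a finite linearly independent \<open>B\<close>, the plane \<open>P + span B\<close> carries the Lebesgue measure
  transported from the coordinate space \<open>\<real>\<^sup>B\<close>. Another base point or basis of the same plane changes
  this measure only by a positive factor, so Lebesgue measurable sets and null sets do not depend on
  the choice.
\<close>

definition plane :: "'v::real_vector \<Rightarrow> 'v set \<Rightarrow> 'v set" where
  "plane P B = (\<lambda>v. P + v) ` span B"

definition plane_lebesgue :: "'v::real_vector \<Rightarrow> 'v set \<Rightarrow> 'v measure" where
  "plane_lebesgue P B =
     embed_measure (completion (\<Pi>\<^sub>M b\<in>B. (lborel :: real measure)))
       (\<lambda>c. P + (\<Sum>b\<in>B. c b *\<^sub>R b))"

lemma inj_on_plane_coordinates: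
  fixes P :: "'v::real_vector"
  assumes "finite B" "independent B"
  shows "inj_on (\<lambda>c. P + (\<Sum>b\<in>B. c b *\<^sub>R b))
           (space (completion (\<Pi>\<^sub>M b\<in>B. (lborel :: real measure))))"
proof (rule inj_onI)
  fix c d :: "'v \<Rightarrow> real"
  assume "c \<in> space (completion (\<Pi>\<^sub>M b\<in>B. (lborel :: real measure)))"
    and "d \<in> space (completion (\<Pi>\<^sub>M b\<in>B. (lborel :: real measure)))"
    and eq: "P + (\<Sum>b\<in>B. c b *\<^sub>R b) = P + (\<Sum>b\<in>B. d b *\<^sub>R b)"
  then have ext: "c \<in> extensional B" "d \<in> extensional B"
    by (auto simp: space_PiM PiE_def)
  have "(\<Sum>b\<in>B. (c b - d b) *\<^sub>R b) = 0"
    using eq by (simp add: scaleR_left_diff_distrib sum_subtractf)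
  then have "c b - d b = 0" if "b \<in> B" for b
    using independentD[OF assms(2,1) subset_refl, of "\<lambda>b. c b - d b" b] that by simp
  then show "c = d"
    by (intro extensionalityI[OF ext]) simp
qed

lemma space_plane_lebesgue:
  assumes "finite B"
  shows "space (plane_lebesgue P B) = plane P B"
proof -
  have "(\<lambda>c. \<Sum>b\<in>B. c b *\<^sub>R b) ` (\<Pi>\<^sub>E b\<in>B. UNIV) = span B"
  proof
    show "(\<lambda>c. \<Sum>b\<in>B. c b *\<^sub>R b) ` (\<Pi>\<^sub>E b\<in>B. UNIV) \<subseteq> span B"
      using span_base by (intro image_subsetI span_sum span_scale) blast
    show "span B \<subseteq> (\<lambda>c. \<Sum>b\<in>B. c b *\<^sub>R b) ` (\<Pi>\<^sub>E b\<in>B. UNIV)"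
    proof
      fix v assume "v \<in> span B"
      then obtain u where "v = (\<Sum>b\<in>B. u b *\<^sub>R b)"
        using span_finite[OF assms] by auto
      then have "v = (\<Sum>b\<in>B. restrict u B b *\<^sub>R b)" by simp
      then show "v \<in> (\<lambda>c. \<Sum>b\<in>B. c b *\<^sub>R b) ` (\<Pi>\<^sub>E b\<in>B. UNIV)"
        by (rule image_eqI[of _ _ "restrict u B"]) auto
    qed
  qed
  then have "(\<lambda>v. P + v) ` ((\<lambda>c. \<Sum>b\<in>B. c b *\<^sub>R b) ` (\<Pi>\<^sub>E b\<in>B. UNIV)) = (\<lambda>v. P + v) ` span B"
    by simp
  then show ?thesis
    by (simp add: plane_lebesgue_def plane_def space_embed_measure space_PiM image_image)
qed

section \<open>Almost every element of a vector space\<close>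

definition plane_measurable :: "'v::real_vector set \<Rightarrow> 'v set \<Rightarrow> bool" where
  "plane_measurable V G \<longleftrightarrow> G \<subseteq> V \<and>
     (\<forall>P B. finite B \<and> independent B \<and> plane P B \<subseteq> V \<longrightarrow>
        plane P B \<inter> G \<in> sets (plane_lebesgue P B))"

definition prevalent_in :: "'v::real_vector set \<Rightarrow> 'v set \<Rightarrow> bool" where
  "prevalent_in V G \<longleftrightarrow>
     (\<exists>B. finite B \<and> independent B \<and> span B \<subseteq> V \<and>
        (\<forall>P\<in>V. AE H in plane_lebesgue 0 B. H + P \<in> G))"

definition finite_dimensional :: "'v::real_vector set \<Rightarrow> bool" where
  "finite_dimensional V \<longleftrightarrow> (\<exists>B. finite B \<and> span B = V)"

definition almost_every :: "'v::real_vector set \<Rightarrow> ('v \<Rightarrow> bool) \<Rightarrow> bool" where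
  "almost_every V Q \<longleftrightarrow>
     (if finite_dimensional V
      then \<forall>B. finite B \<and> independent B \<and> span B = V \<longrightarrow> (AE F in plane_lebesgue 0 B. Q F)
      else \<exists>G. plane_measurable V G \<and> prevalent_in V G \<and> (\<forall>F\<in>G. Q F))"

section \<open>Almost constant rank\<close>

definition maxrank :: "(real^'n) set \<Rightarrow> (real^'n \<Rightarrow> real^'m) set \<Rightarrow> nat" where
  "maxrank U \<F> = Max {rank (jacobian F (at x)) | F x. F \<in> \<F> \<and> x \<in> U}"

definition ACR :: "(real^'n) set \<Rightarrow> (real^'n \<Rightarrow> real^'m) set \<Rightarrow> bool" where
  "ACR U \<F> \<longleftrightarrow>
     almost_every \<F> (\<lambda>F. AE x in lebesgue_on U. rank (jacobian F (at x)) = maxrank U \<F>)"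

end

theory Submission
  imports Defs "HOL-Complex_Analysis.Conformal_Mappings"
begin

text \<open>
  Let \<open>r\<close> be the maximal rank, attained by \<open>F\<^sub>0\<close> at \<open>x\<^sub>0\<close>. For suitable matrices \<open>L\<close>, \<open>K\<close>, nonvanishing
  of \<open>det (L A + K)\<close> forces \<open>rank A \<ge> r\<close>. If the Jacobian of \<open>F\<close> at \<open>x\<^sub>0\<close> has rank \<open>r\<close>, such a
  determinant is an analytic function of \<open>x\<close>, not identically zero on the connected set \<open>U\<close>, so it
  vanishes only on a null set. It remains that almost every \<open>F\<close> has rank \<open>r\<close> at \<open>x\<^sub>0\<close>. On a plane
  \<open>P + X\<close> with \<open>F\<^sub>0 \<in> X\<close> the function \<open>P + t F\<^sub>0\<close> has rank \<open>r\<close> there for large \<open>t\<close>, and the determinant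
  chosen for it is a polynomial in the coordinates of the plane, hence nonzero almost everywhere.

  Both null set statements need analyticity only along coordinate lines: the restriction to such a
  line extends holomorphically, so its zeros are countable unless it vanishes identically, and
  Fubini's theorem does the rest.
\<close>

section \<open>Lower semicontinuity of the rank\<close>

text \<open>The kernel is the orthogonal complement of the row space, whose dimension is the
  rank.\<close>

lemma rank_plus_dim_kernel:
  fixes A :: "real^'n^'m"
  shows "rank A + dim {x. A *v x = 0} = CARD('n)"
proof -
  have "(A *v x = 0) = (\<forall>y\<in>span (rows A). orthogonal y x)" for x
  proof
    assume "A *v x = 0"
    then show "\<forall>y\<in>span (rows A). orthogonal y x"
      using orthogonal_nullspace_rowspace orthogonal_commute by blast
  next
    assume "\<forall>y\<in>span (rows A). orthogonal y x"
    then have "orthogonal (row i A) x" for i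
      by (auto simp: rows_def intro: span_base)
    then show "A *v x = 0"
      by (simp add: vec_eq_iff matrix_vector_mul_component orthogonal_def row_def)
  qed
  then have "{x. A *v x = 0} = {x \<in> UNIV. \<forall>y\<in>span (rows A). orthogonal y x}"
    by auto
  moreover have "dim {x \<in> UNIV. \<forall>y\<in>span (rows A). orthogonal y x} + dim (span (rows A)) = dim (UNIV :: (real^'n) set)"
    by (rule dim_subspace_orthogonal_to_vectors) auto
  ultimately show ?thesis
    by (simp add: row_rank_def)
qed

text \<open>Plays the role of a nonvanishing minor, without choosing rows and columns.
  \<open>K\<close> represents a projection \<open>k\<close> onto the kernel of \<open>A\<close>, and
  \<open>L\<close> a map \<open>l\<close> inverting \<open>A\<close> on the complement
  \<open>ker k\<close>. If \<open>L ** B + K\<close> is invertible, then \<open>k\<close> is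
  injective on the kernel of \<open>B\<close>, which is therefore at most as large as that of
  \<open>A\<close>.\<close>

lemma rank_certificate:
  fixes A :: "real^'n^'m"
  obtains L :: "real^'m^'n" and K :: "real^'n^'n"
  where "L ** A + K = mat 1"
    and "\<And>B :: real^'n^'m. det (L ** B + K) \<noteq> 0 \<Longrightarrow> rank A \<le> rank B"
proof -
  define W where "W = {x. A *v x = 0}"
  have subW: "subspace W"
    unfolding W_def by (rule linear_subspace_kernel) simp
  obtain k where k: "k ` UNIV \<subseteq> W" "linear k" "\<forall>v\<in>W. k (id v) = v"
    using linear_exists_left_inverse_on[OF linear_id subW] by auto
  define V where "V = {x. k x = 0}"
  have subV: "subspace V"
    unfolding V_def using k(2) by (rule linear_subspace_kernel)
  have "inj_on ((*v) A) V"
  proof (rule inj_onI)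
    fix x y assume xy: "x \<in> V" "y \<in> V" "A *v x = A *v y"
    have "x - y \<in> W" "x - y \<in> V"
      using xy subV by (auto simp: W_def matrix_vector_mult_diff_distrib subspace_diff)
    then show "x = y" using k(3) by (auto simp: V_def)
  qed
  then obtain l where l: "linear l" "\<forall>v\<in>V. l (A *v v) = v"
    using linear_exists_left_inverse_on[of "(*v) A" V] subV by auto
  \<comment> \<open>Split \<open>x\<close> into \<open>k x\<close> in \<open>W\<close> and
    \<open>x - k x\<close> in \<open>V\<close>: \<open>A\<close> kills the first summand and
    \<open>l\<close> recovers the second.\<close>
  have id: "l (A *v x) + k x = x" for x
  proof -
    have kx: "k x \<in> W" using k(1) by auto
    have "k (x - k x) = 0"
      using k(3) kx by (simp add: linear_diff[OF k(2)])
    then have "l (A *v (x - k x)) = x - k x" using l(2) by (auto simp: V_def)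
    moreover have "A *v (x - k x) = A *v x"
      using kx by (simp add: W_def matrix_vector_mult_diff_distrib)
    ultimately show ?thesis by simp
  qed
  show thesis
  proof
    show "matrix l ** A + matrix k = mat 1"
      by (simp add: matrix_eq matrix_vector_mult_add_rdistrib matrix_works l(1) k(2) id
          flip: matrix_vector_mul_assoc)
    fix B :: "real^'n^'m"
    assume det: "det (matrix l ** B + matrix k) \<noteq> 0"
    have dimA: "rank A + dim W = CARD('n)"
      unfolding W_def by (rule rank_plus_dim_kernel)
    have dimB: "rank B + dim {x. B *v x = 0} = CARD('n)"
      by (rule rank_plus_dim_kernel)
    have "dim {x. B *v x = 0} = dim (k ` {x. B *v x = 0})"
    proof (rule dim_image_eq[symmetric])
      show "linear k" by fact
      have sub: "subspace {x. B *v x = 0}"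
        by (rule linear_subspace_kernel) simp
      have inv: "invertible (matrix l ** B + matrix k)"
        using det by (simp add: invertible_det_nz)
      \<comment> \<open>On the kernel of \<open>B\<close> the invertible matrix acts as
        \<open>k\<close> alone.\<close>
      have "x = 0" if "B *v x = 0" "k x = 0" for x
      proof -
        have "(matrix l ** B + matrix k) *v x = (matrix l ** B + matrix k) *v 0"
          using that by (simp add: matrix_vector_mult_add_rdistrib matrix_works l(1) k(2) linear_0
              flip: matrix_vector_mul_assoc)
        then show "x = 0"
          using inj_matrix_vector_mult[OF inv] by (blast dest: injD)
      qed
      then show "inj_on k (span {x. B *v x = 0})"
        by (subst span_eq_iff[THEN iffD2, OF sub]) (simp add: linear_injective_on_subspace_0[OF k(2) sub])
    qed
    also have "\<dots> \<le> dim W" using k(1) by (intro dim_subset) auto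
    finally show "rank A \<le> rank B" using dimA dimB by linarith
  qed
qed



text \<open>Around \<open>A\<close>, the set where the certificate determinant of \<open>A\<close>
  is nonzero is an open neighbourhood; at \<open>A\<close> itself that determinant is 1.\<close>

lemma open_rank_ge: "open {A :: real^'n^'m. r \<le> rank A}"
proof (subst open_subopen, intro ballI)
  fix A :: "real^'n^'m" assume A: "A \<in> {A. r \<le> rank A}"
  obtain L :: "real^'m^'n" and K :: "real^'n^'n"
    where LK: "L ** A + K = mat 1" "\<And>B :: real^'n^'m. det (L ** B + K) \<noteq> 0 \<Longrightarrow> rank A \<le> rank B"
    using rank_certificate by blast
  have "continuous_on UNIV (\<lambda>B :: real^'n^'m. det (L ** B + K))"
    unfolding det_def matrix_matrix_mult_def by (simp, intro continuous_intros)
  then have "open {B :: real^'n^'m. det (L ** B + K) \<noteq> 0}"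
    by (intro open_Collect_neq) auto
  then show "\<exists>T. open T \<and> A \<in> T \<and> T \<subseteq> {A. r \<le> rank A}"
    using LK A by (intro exI[of _ "{B. det (L ** B + K) \<noteq> 0}"]) (auto intro: order_trans)
qed

section \<open>Real functions with a holomorphic extension\<close>

text \<open>Analyticity in one real variable, encoded through a complex extension so that the theory
  of holomorphic zeros applies. Only the real points of \<open>S\<close> matter for
  \<open>g\<close>. In use, \<open>S\<close> is a disc with real centre or the whole plane.\<close>

definition holo_ext :: "complex set \<Rightarrow> (real \<Rightarrow> real) \<Rightarrow> bool" where
  "holo_ext S g \<longleftrightarrow> (\<exists>\<phi>. \<phi> holomorphic_on S \<and> (\<forall>t. of_real t \<in> S \<longrightarrow> \<phi> (of_real t) = of_real (g t)))"

lemma holo_extI: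
  assumes "\<phi> holomorphic_on S" "\<And>t. of_real t \<in> S \<Longrightarrow> \<phi> (of_real t) = of_real (g t)"
  shows "holo_ext S g"
  using assms unfolding holo_ext_def by blast

lemma holo_ext_cong:
  assumes "\<And>t. of_real t \<in> S \<Longrightarrow> f t = g t"
  shows "holo_ext S f \<longleftrightarrow> holo_ext S g"
  using assms unfolding holo_ext_def by metis

lemma holo_ext_const [intro]: "holo_ext S (\<lambda>_. c)"
  by (rule holo_extI[of "\<lambda>_. of_real c"]) auto

lemma holo_ext_ident [intro]: "holo_ext S (\<lambda>t. t)"
  by (rule holo_extI[of "\<lambda>z. z"]) auto

lemma holo_ext_add [intro]:
  assumes "holo_ext S f" "holo_ext S g" shows "holo_ext S (\<lambda>t. f t + g t)"
proof -
  obtain \<phi> \<psi> where "\<phi> holomorphic_on S" "\<psi> holomorphic_on S"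
    "\<forall>t. of_real t \<in> S \<longrightarrow> \<phi> (of_real t) = of_real (f t)"
    "\<forall>t. of_real t \<in> S \<longrightarrow> \<psi> (of_real t) = of_real (g t)"
    using assms unfolding holo_ext_def by blast
  then show ?thesis
    by (intro holo_extI[of "\<lambda>z. \<phi> z + \<psi> z"]) (auto intro: holomorphic_intros)
qed

lemma holo_ext_mult [intro]:
  assumes "holo_ext S f" "holo_ext S g" shows "holo_ext S (\<lambda>t. f t * g t)"
proof -
  obtain \<phi> \<psi> where "\<phi> holomorphic_on S" "\<psi> holomorphic_on S"
    "\<forall>t. of_real t \<in> S \<longrightarrow> \<phi> (of_real t) = of_real (f t)"
    "\<forall>t. of_real t \<in> S \<longrightarrow> \<psi> (of_real t) = of_real (g t)"
    using assms unfolding holo_ext_def by blast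
  then show ?thesis
    by (intro holo_extI[of "\<lambda>z. \<phi> z * \<psi> z"]) (auto intro: holomorphic_intros)
qed

lemma holo_ext_sum [intro]:
  "(\<And>i. i \<in> I \<Longrightarrow> holo_ext S (f i)) \<Longrightarrow> holo_ext S (\<lambda>t. \<Sum>i\<in>I. f i t)"
  by (induction I rule: infinite_finite_induct) auto

lemma holo_ext_prod [intro]:
  "(\<And>i. i \<in> I \<Longrightarrow> holo_ext S (f i)) \<Longrightarrow> holo_ext S (\<lambda>t. \<Prod>i\<in>I. f i t)"
  by (induction I rule: infinite_finite_induct) auto

lemma holo_ext_det:
  assumes "\<And>i j. holo_ext S (\<lambda>t. M t $ i $ j)"
  shows "holo_ext S (\<lambda>t. det (M t))"
  unfolding det_def by (intro holo_ext_sum holo_ext_mult holo_ext_prod holo_ext_const assms)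

text \<open>Exhaustion by compact sets; this supplies the domain condition for the countability of
  holomorphic zeros.\<close>

lemma fsigma_open:
  fixes S :: "'a::euclidean_space set"
  assumes "open S"
  shows "fsigma S"
proof -
  obtain C :: "nat \<Rightarrow> 'a set" where C: "\<And>n. compact (C n)" "\<Union>(range C) = S"
    using open_Union_compact_subsets[OF assms] by metis
  then show ?thesis
    using compact_imp_closed fsigma.intros by metis
qed

text \<open>A nonconstant holomorphic function on a connected open set has countably many zeros, and
  the embedding of the reals is injective. A constant extension vanishes everywhere or
  nowhere.\<close>

lemma holo_ext_zeros:
  assumes g: "holo_ext S g" and S: "open S" "connected S"
  shows "countable {t. of_real t \<in> S \<and> g t = 0} \<or> (\<forall>t. of_real t \<in> S \<longrightarrow> g t = 0)"
proof -
  obtain \<phi> where \<phi>: "\<phi> holomorphic_on S" "\<And>t. of_real t \<in> S \<Longrightarrow> \<phi> (of_real t) = of_real (g t)"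
    using g unfolding holo_ext_def by blast
  show ?thesis
  proof (cases "\<phi> constant_on S")
    case True
    then obtain c where c: "\<And>z. z \<in> S \<Longrightarrow> \<phi> z = c"
      unfolding constant_on_def by blast
    show ?thesis
    proof (cases "c = 0")
      case True
      then have "g t = 0" if "of_real t \<in> S" for t
        using \<phi>(2)[OF that] c[OF that] by simp
      then show ?thesis by blast
    next
      case False
      then have "g t \<noteq> 0" if "of_real t \<in> S" for t
        using \<phi>(2)[OF that] c[OF that] by auto
      then have empty: "{t. of_real t \<in> S \<and> g t = 0} = {}" by blast
      show ?thesis unfolding empty by simp
    qed
  next
    case False
    then have "countable {z\<in>S. \<phi> z = 0}"
      using holomorphic_countable_zeros \<phi>(1) S fsigma_open by blast
    moreover have "of_real ` {t. of_real t \<in> S \<and> g t = 0} \<subseteq> {z\<in>S. \<phi> z = 0}"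
      using \<phi>(2) by auto
    ultimately have "countable ((of_real :: real \<Rightarrow> complex) ` {t. of_real t \<in> S \<and> g t = 0})"
      by (rule countable_subset[rotated])
    then show ?thesis
      by (simp add: countable_image_inj_eq inj_on_def)
  qed
qed

section \<open>Zero sets of functions analytic along coordinate lines\<close>

text \<open>Induction on the number of coordinates with Fubini's theorem. Freezing the new
  coordinate at its value in the witness \<open>d\<close> keeps the function nonzero somewhere, so
  by induction it is nonzero at almost every point of the slice. Through such a point, the line in
  the new direction meets the zero set in a countable, hence null, set.\<close>

lemma AE_PiM_nonzero:
  fixes f :: "('i \<Rightarrow> real) \<Rightarrow> real" and J :: "'i \<Rightarrow> real set"
  assumes "finite I"
    and "{c \<in> PiE I J. f c = 0} \<in> sets (PiM I (\<lambda>_. lborel))"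
    and "\<And>c i. c \<in> PiE I J \<Longrightarrow> i \<in> I \<Longrightarrow>
           countable {t \<in> J i. f (c(i := t)) = 0} \<or> (\<forall>t\<in>J i. f (c(i := t)) = 0)"
    and "d \<in> PiE I J" "f d \<noteq> 0"
  shows "AE c in PiM I (\<lambda>_. lborel). c \<in> PiE I J \<longrightarrow> f c \<noteq> 0"
  using assms
proof (induction I arbitrary: f d rule: finite_induct)
  case empty
  then have "f c \<noteq> 0" if "c \<in> PiE {} J" for c
    using that by simp
  then show ?case by simp
next
  case (insert i I)
  interpret product_sigma_finite "\<lambda>_::'i. lborel :: real measure" ..
  let ?M = "\<lambda>I. PiM I (\<lambda>_::'i. lborel :: real measure)"
  define N where "N = {c \<in> PiE (insert i I) J. f c = 0}"
  have N: "N \<in> sets (?M (insert i I))"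
    using insert.prems(1) unfolding N_def .
  \<comment> \<open>Points of \<open>PiE I J\<close> take the value \<open>undefined\<close> off
    \<open>I\<close>, so coordinate \<open>i\<close> is reset; writing \<open>d i\<close> back
    recovers \<open>d\<close>.\<close>
  have d: "d i \<in> J i" "d(i := undefined) \<in> PiE I J"
    using insert.prems(3) insert.hyps(2) by (auto simp: PiE_iff extensional_def)
  have upd: "c(i := t) \<in> PiE (insert i I) J \<longleftrightarrow> t \<in> J i \<and> c \<in> PiE I J"
    if "c \<in> extensional I" for c t
    using that insert.hyps(2) by (auto simp: PiE_iff extensional_def)
  have "AE c in ?M I. c \<in> PiE I J \<longrightarrow> f (c(i := d i)) \<noteq> 0"
  proof (rule insert.IH[where d = "d(i := undefined)"])
    have "(\<lambda>c. c(i := d i)) \<in> measurable (?M I) (?M (insert i I))"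
      by (rule measurable_fun_upd[of _ I]) (auto simp: insert.hyps)
    then have "(\<lambda>c. c(i := d i)) -` N \<inter> space (?M I) \<in> sets (?M I)"
      using N by (rule measurable_sets)
    moreover have "(\<lambda>c. c(i := d i)) -` N \<inter> space (?M I) = {c \<in> PiE I J. f (c(i := d i)) = 0}"
    proof (rule set_eqI)
      fix c
      show "c \<in> (\<lambda>c. c(i := d i)) -` N \<inter> space (?M I) \<longleftrightarrow> c \<in> {c \<in> PiE I J. f (c(i := d i)) = 0}"
        using d(1) upd[of c "d i"] by (cases "c \<in> extensional I") (auto simp: N_def space_PiM PiE_def)
    qed
    ultimately show "{c \<in> PiE I J. f (c(i := d i)) = 0} \<in> sets (?M I)" by simp
  next
    fix c j assume c: "c \<in> PiE I J" and j: "j \<in> I"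
    then have "c(i := d i) \<in> PiE (insert i I) J"
      using upd[of c "d i"] d(1) by (auto simp: PiE_def)
    moreover have "i \<noteq> j" using j insert.hyps(2) by auto
    moreover from this have "(c(j := t))(i := d i) = (c(i := d i))(j := t)" for t
      by (metis fun_upd_twist)
    ultimately show "countable {t \<in> J j. f ((c(j := t))(i := d i)) = 0} \<or>
        (\<forall>t\<in>J j. f ((c(j := t))(i := d i)) = 0)"
      using insert.prems(2)[of "c(i := d i)" j] j by (simp del: fun_upd_apply)
  next
    show "d(i := undefined) \<in> PiE I J" by (rule d(2))
    show "f ((d(i := undefined))(i := d i)) \<noteq> 0" using insert.prems(4) by simp
  qed
  \<comment> \<open>The nonzero value at \<open>d i\<close> rules out that the line through
    \<open>c\<close> lies in the zero set. For \<open>c\<close> outside \<open>PiE I J\<close> the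
    section of \<open>N\<close> is empty.\<close>
  moreover have "(\<integral>\<^sup>+ y. indicator N (c(i := y)) \<partial>lborel) = 0"
    if c: "c \<in> space (?M I)" and nz: "c \<in> PiE I J \<longrightarrow> f (c(i := d i)) \<noteq> 0" for c
  proof (cases "c \<in> PiE I J")
    case False
    then have "c(i := y) \<notin> N" for y
      using c upd[of c y] by (auto simp: N_def space_PiM PiE_def)
    then show ?thesis by simp
  next
    case True
    then have "c(i := d i) \<in> PiE (insert i I) J"
      using upd[of c "d i"] d(1) by (auto simp: PiE_def)
    then have "countable {t \<in> J i. f ((c(i := d i))(i := t)) = 0} \<or> (\<forall>t\<in>J i. f ((c(i := d i))(i := t)) = 0)"
      using insert.prems(2) by blast
    then have "countable {t \<in> J i. f (c(i := t)) = 0}"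
      using nz True d(1) unfolding fun_upd_upd by blast
    moreover have "(c(i := y) \<in> N) = (y \<in> {t \<in> J i. f (c(i := t)) = 0})" for y
      using True upd[of c y] by (auto simp: N_def PiE_def)
    then have "(\<lambda>y. indicator N (c(i := y)) :: ennreal) = indicator {t \<in> J i. f (c(i := t)) = 0}"
      by (auto simp: indicator_def fun_eq_iff)
    ultimately show ?thesis
      by (simp add: emeasure_lborel_countable sets.countable)
  qed
  ultimately have "AE c in ?M I. (\<integral>\<^sup>+ y. indicator N (c(i := y)) \<partial>lborel) = 0"
    by (auto elim!: AE_mp)
  then have "(\<integral>\<^sup>+ c. (\<integral>\<^sup>+ y. indicator N (c(i := y)) \<partial>lborel) \<partial>?M I) = 0"
    by (subst nn_integral_cong_AE) auto
  then have "emeasure (?M (insert i I)) N = 0"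
    using product_nn_integral_insert[OF insert.hyps, of "indicator N"] N by simp
  then have "N \<in> null_sets (?M (insert i I))" using N by auto
  then have "AE c in ?M (insert i I). c \<notin> N" by (rule AE_not_in)
  then show ?case by (simp add: N_def)
qed

text \<open>The coordinate map \<phi> carries the product measure to Lebesgue measure and product
  intervals to boxes, so the product statement \<open>AE_PiM_nonzero\<close> transfers.\<close>

lemma negligible_zeros_box:
  fixes h :: "'a::euclidean_space \<Rightarrow> real"
  assumes cont: "continuous_on (box a b) h"
    and line: "\<And>x e. x \<in> box a b \<Longrightarrow> e \<in> Basis \<Longrightarrow>
      countable {t \<in> {a \<bullet> e<..<b \<bullet> e}. h (x + (t - x \<bullet> e) *\<^sub>R e) = 0} \<or>
      (\<forall>t\<in>{a \<bullet> e<..<b \<bullet> e}. h (x + (t - x \<bullet> e) *\<^sub>R e) = 0)"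
    and x0: "x0 \<in> box a b" "h x0 \<noteq> 0"
  shows "negligible {x \<in> box a b. h x = 0}"
proof -
  let ?P = "PiM Basis (\<lambda>_::'a. lborel :: real measure)"
  define \<phi> :: "('a \<Rightarrow> real) \<Rightarrow> 'a" where "\<phi> c = (\<Sum>e\<in>Basis. c e *\<^sub>R e)" for c
  define J where "J e = {a \<bullet> e<..<b \<bullet> e}" for e
  define Z where "Z = {x \<in> box a b. h x = 0}"
  have \<phi>_inner: "\<phi> c \<bullet> e = c e" if "e \<in> Basis" for c e
    using that by (simp add: \<phi>_def)
  have \<phi>_box: "\<phi> c \<in> box a b \<longleftrightarrow> (\<forall>e\<in>Basis. c e \<in> J e)" for c
    by (auto simp: mem_box J_def \<phi>_inner)
  \<comment> \<open>Changing one coordinate is a move along the axis \<open>e\<close> to the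
    position \<open>t\<close>; this is the form of the hypothesis \<open>line\<close>.\<close>
  have \<phi>_upd: "\<phi> (c(e := t)) = \<phi> c + (t - \<phi> c \<bullet> e) *\<^sub>R e" if "e \<in> Basis" for c e t
    by (rule euclidean_eqI) (use that in \<open>auto simp: \<phi>_inner inner_add_left inner_Basis\<close>)
  have \<phi>_meas: "\<phi> \<in> measurable ?P borel"
    unfolding \<phi>_def by measurable
  \<comment> \<open>Continuity makes the zero set relatively closed in an open box, hence
    Borel.\<close>
  have "closedin (top_of_set (box a b)) Z"
    using continuous_closedin_preimage[OF cont, of "{0}"] by (simp add: Z_def vimage_def Collect_conj_eq)
  then obtain T where "closed T" "Z = box a b \<inter> T"
    by (auto simp: closedin_closed)
  then have Z: "Z \<in> sets borel"
    by (simp add: sets.Int borel_open borel_closed)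
  have "AE c in ?P. c \<in> PiE Basis J \<longrightarrow> h (\<phi> c) \<noteq> 0"
  proof (rule AE_PiM_nonzero)
    have "\<phi> -` Z \<inter> space ?P \<in> sets ?P"
      using \<phi>_meas Z by (rule measurable_sets)
    moreover have "\<phi> -` Z \<inter> space ?P = {c \<in> PiE Basis J. h (\<phi> c) = 0}"
      by (auto simp: Z_def space_PiM PiE_def Pi_iff \<phi>_box)
    ultimately show "{c \<in> PiE Basis J. h (\<phi> c) = 0} \<in> sets ?P" by simp
  next
    fix c and e :: 'a assume "c \<in> PiE Basis J" "e \<in> Basis"
    then show "countable {t \<in> J e. h (\<phi> (c(e := t))) = 0} \<or> (\<forall>t\<in>J e. h (\<phi> (c(e := t))) = 0)"
      using line[of "\<phi> c" e] by (auto simp: \<phi>_box J_def \<phi>_upd PiE_iff)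
  next
    show "restrict (\<lambda>e. x0 \<bullet> e) Basis \<in> PiE Basis J"
      using x0(1) by (auto simp: mem_box J_def)
    have "\<phi> (restrict (\<lambda>e. x0 \<bullet> e) Basis) = x0"
      by (rule euclidean_eqI) (simp add: \<phi>_inner)
    then show "h (\<phi> (restrict (\<lambda>e. x0 \<bullet> e) Basis)) \<noteq> 0" using x0(2) by simp
  qed simp
  then have "AE c in ?P. \<phi> c \<notin> Z"
    by (rule AE_mp) (auto simp: Z_def \<phi>_box space_PiM PiE_iff)
  moreover have "{x \<in> space borel. x \<notin> Z} \<in> sets borel"
    using Z by (simp add: Collect_neg_eq borel_comp)
  ultimately have "AE x in distr ?P borel \<phi>. x \<notin> Z"
    using \<phi>_meas by (simp add: AE_distr_iff)
  moreover have "distr ?P borel \<phi> = lborel"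
    unfolding \<phi>_def by (rule lborel_eq[symmetric])
  ultimately have "AE x in lborel. x \<notin> Z" by (rule back_subst[where P = "\<lambda>M. AE x in M. x \<notin> Z"])
  then have "Z \<in> null_sets lborel"
    using Z AE_iff_null_sets[of Z lborel] by auto
  then have "Z \<in> null_sets lebesgue"
    by (rule null_sets_completionI)
  then show ?thesis
    by (simp add: negligible_iff_null_sets Z_def)
qed

text \<open>On each small box \<open>h\<close> vanishes identically or has a negligible zero set.
  These alternatives define open sets \<open>V\<close> and \<open>W\<close> covering
  \<open>U\<close>. They are disjoint because a nonempty open set is not negligible, so
  connectedness and \<open>x0\<close> force \<open>U\<close> into \<open>W\<close>.\<close>

lemma negligible_zeros_connected:
  fixes h :: "'a::euclidean_space \<Rightarrow> real"
  assumes U: "open U" "connected U"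
    and cont: "continuous_on U h"
    and loc: "\<And>x. x \<in> U \<Longrightarrow> \<exists>a b. x \<in> box a b \<and> box a b \<subseteq> U \<and>
      (\<forall>y\<in>box a b. \<forall>e\<in>Basis.
        countable {t \<in> {a \<bullet> e<..<b \<bullet> e}. h (y + (t - y \<bullet> e) *\<^sub>R e) = 0} \<or>
        (\<forall>t\<in>{a \<bullet> e<..<b \<bullet> e}. h (y + (t - y \<bullet> e) *\<^sub>R e) = 0))"
    and x0: "x0 \<in> U" "h x0 \<noteq> 0"
  shows "negligible {x \<in> U. h x = 0}"
proof -
  define V where "V = \<Union>{T. open T \<and> T \<subseteq> U \<and> (\<forall>x\<in>T. h x = 0)}"
  define W where "W = \<Union>{T. open T \<and> T \<subseteq> U \<and> negligible {x \<in> T. h x = 0}}"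
  have VW: "U \<subseteq> V \<union> W"
  proof
    fix x assume "x \<in> U"
    then obtain a b where ab: "x \<in> box a b" "box a b \<subseteq> U"
      "\<And>y e. y \<in> box a b \<Longrightarrow> e \<in> Basis \<Longrightarrow>
        countable {t \<in> {a \<bullet> e<..<b \<bullet> e}. h (y + (t - y \<bullet> e) *\<^sub>R e) = 0} \<or>
        (\<forall>t\<in>{a \<bullet> e<..<b \<bullet> e}. h (y + (t - y \<bullet> e) *\<^sub>R e) = 0)"
      using loc[OF \<open>x \<in> U\<close>] by (elim exE conjE) blast
    show "x \<in> V \<union> W"
    proof (cases "\<forall>y\<in>box a b. h y = 0")
      case True
      then have "box a b \<subseteq> V" using ab(2) unfolding V_def by (intro Union_upper) auto
      then show ?thesis using ab(1) by blast
    next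
      case False
      then obtain y where "y \<in> box a b" "h y \<noteq> 0" by blast
      then have "negligible {x \<in> box a b. h x = 0}"
        using negligible_zeros_box[OF continuous_on_subset[OF cont ab(2)] ab(3)] by blast
      then have "box a b \<subseteq> W" using ab(2) unfolding W_def by (intro Union_upper) auto
      then show ?thesis using ab(1) by blast
    qed
  qed
  have "V \<inter> W = {}"
  proof (rule ccontr)
    assume "V \<inter> W \<noteq> {}"
    then obtain S T where ST: "open S" "\<forall>x\<in>S. h x = 0" "open T" "negligible {x \<in> T. h x = 0}" "S \<inter> T \<noteq> {}"
      unfolding V_def W_def by auto
    then have "negligible (S \<inter> T)"
      by (elim negligible_subset) auto
    then show False using open_not_negligible[OF open_Int[OF ST(1,3)]] ST(5) by blast
  qed
  moreover have "open V" "open W" by (auto simp: V_def W_def)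
  ultimately have "V \<inter> U = {} \<or> W \<inter> U = {}"
    using connectedD[OF U(2), of V W] VW by blast
  moreover have "x0 \<notin> V" using x0 by (auto simp: V_def)
  ultimately have UW: "U \<subseteq> W" using VW x0(1) by blast
  show ?thesis
  \<comment> \<open>Negligibility is a local property, so the sets making up \<open>W\<close>
    suffice.\<close>
  proof (subst locally_negligible_alt, intro ballI)
    fix x assume "x \<in> {x \<in> U. h x = 0}"
    then obtain T where T: "open T" "T \<subseteq> U" "negligible {x \<in> T. h x = 0}" "x \<in> T" "h x = 0"
      using UW unfolding W_def by auto
    show "\<exists>S. openin (top_of_set {x \<in> U. h x = 0}) S \<and> x \<in> S \<and> negligible S"
      using T by (intro exI[of _ "{x \<in> T. h x = 0}"]) (auto simp: openin_open intro!: exI[of _ T])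
  qed
qed

section \<open>Jacobians of real analytic maps\<close>

text \<open>The \<open>j\<close>-th partial derivative of the monomial with exponents \<open>\<alpha>\<close>, also at complex points.\<close>

definition partial_monomial :: "'n \<Rightarrow> ('n \<Rightarrow> nat) \<Rightarrow> ('n::finite \<Rightarrow> 'a::real_normed_field) \<Rightarrow> 'a" where
  "partial_monomial j \<alpha> w = of_nat (\<alpha> j) * w j ^ (\<alpha> j - 1) * (\<Prod>i\<in>UNIV - {j}. w i ^ \<alpha> i)"

lemma partial_monomial_of_real: "partial_monomial j \<alpha> (\<lambda>i. of_real (w i)) = of_real (partial_monomial j \<alpha> w)"
  by (simp add: partial_monomial_def)

lemma holomorphic_partial_monomial:
  "(\<lambda>z. partial_monomial j \<alpha> (\<lambda>i. if i = k then z - p else q i)) holomorphic_on S"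
proof -
  have "(\<lambda>z. if i = k then z - p else q i) holomorphic_on S" for i
    by (cases "i = k") (auto intro!: holomorphic_intros)
  then show ?thesis
    unfolding partial_monomial_def by (intro holomorphic_intros)
qed

lemma continuous_partial_monomial:
  fixes a :: "real^'n"
  shows "continuous_on S (\<lambda>x. partial_monomial j \<alpha> (\<lambda>i. x $ i - a $ i))"
  unfolding partial_monomial_def by (intro continuous_intros)

lemma has_derivative_monomial:
  fixes a :: "real^'n"
  shows "((\<lambda>x. \<Prod>i\<in>UNIV. (x $ i - a $ i) ^ \<alpha> i) has_derivative
     (\<lambda>h. \<Sum>j\<in>UNIV. partial_monomial j \<alpha> (\<lambda>i. x $ i - a $ i) * h $ j)) (at x within S)"
proof -
  have "((\<lambda>x. (x $ i - a $ i) ^ \<alpha> i) has_derivative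
     (\<lambda>h. of_nat (\<alpha> i) * (h $ i) * (x $ i - a $ i) ^ (\<alpha> i - 1))) (at x within S)" for i
    by (auto intro!: derivative_eq_intros bounded_linear_imp_has_derivative bounded_linear_vec_nth)
  then have "((\<lambda>x. \<Prod>i\<in>UNIV. (x $ i - a $ i) ^ \<alpha> i) has_derivative
     (\<lambda>h. \<Sum>j\<in>UNIV. (of_nat (\<alpha> j) * (h $ j) * (x $ j - a $ j) ^ (\<alpha> j - 1)) *
        (\<Prod>i\<in>UNIV - {j}. (x $ i - a $ i) ^ \<alpha> i))) (at x within S)"
    by (rule has_derivative_prod)
  then show ?thesis
    by (simp add: partial_monomial_def mult_ac)
qed

text \<open>Halving the radius pays for the factor \<open>n\<close> produced by differentiation,
  since \<open>n\<close> is at most \<open>2 ^ n\<close>. For \<open>n = 0\<close> the left side is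
  0.\<close>

lemma of_nat_mult_half_power_le:
  fixes \<rho> :: real
  assumes "\<rho> > 0"
  shows "real n * (\<rho> / 2) ^ (n - 1) \<le> 2 / \<rho> * \<rho> ^ n"
proof (cases n)
  case (Suc m)
  have "real n \<le> 2 ^ n" using of_nat_less_two_power[of n, where 'a = real] by simp
  then have "real n * (\<rho> / 2) ^ m \<le> 2 ^ n * (\<rho> / 2) ^ m"
    using assms by (intro mult_right_mono) auto
  also have "\<dots> = 2 / \<rho> * \<rho> ^ n"
    using assms by (simp add: Suc power_divide)
  finally show ?thesis by (simp add: Suc)
qed (use assms in simp)

text \<open>Bounds a differentiated monomial on the half-size polydisc by the monomial itself at
  radius \<rho>. One bound serves real and complex points.\<close>

lemma norm_partial_monomial_le:
  assumes "\<rho> > 0" and w: "\<And>i. norm (w i) \<le> \<rho> / 2"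
  shows "norm (partial_monomial j \<alpha> w) \<le> 2 / \<rho> * (\<Prod>i\<in>UNIV. \<rho> ^ \<alpha> i)"
proof -
  have "norm (partial_monomial j \<alpha> w) =
      (real (\<alpha> j) * norm (w j) ^ (\<alpha> j - 1)) * (\<Prod>i\<in>UNIV - {j}. norm (w i) ^ \<alpha> i)"
    by (simp add: partial_monomial_def norm_mult norm_power prod_norm flip: prod_norm)
  also have "\<dots> \<le> (2 / \<rho> * \<rho> ^ \<alpha> j) * (\<Prod>i\<in>UNIV - {j}. \<rho> ^ \<alpha> i)"
  proof (rule mult_mono)
    have "real (\<alpha> j) * norm (w j) ^ (\<alpha> j - 1) \<le> real (\<alpha> j) * (\<rho> / 2) ^ (\<alpha> j - 1)"
      by (intro mult_left_mono power_mono w) auto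
    also have "\<dots> \<le> 2 / \<rho> * \<rho> ^ \<alpha> j"
      by (rule of_nat_mult_half_power_le) fact
    finally show "real (\<alpha> j) * norm (w j) ^ (\<alpha> j - 1) \<le> 2 / \<rho> * \<rho> ^ \<alpha> j" .
    have "norm (w i) \<le> \<rho>" for i using w[of i] assms(1) by simp
    then show "(\<Prod>i\<in>UNIV - {j}. norm (w i) ^ \<alpha> i) \<le> (\<Prod>i\<in>UNIV - {j}. \<rho> ^ \<alpha> i)"
      by (intro prod_mono conjI power_mono) auto
  qed (use assms(1) in \<open>auto intro!: prod_nonneg\<close>)
  also have "\<dots> = 2 / \<rho> * (\<Prod>i\<in>UNIV. \<rho> ^ \<alpha> i)"
    by (subst prod.remove[of UNIV j]) auto
  finally show ?thesis .
qed

section \<open>Termwise differentiation of multi-index power series\<close>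

lemma infinite_multi_indices: "infinite (UNIV :: ('n::finite \<Rightarrow> nat) set)"
proof
  assume "finite (UNIV :: ('n \<Rightarrow> nat) set)"
  then have "finite (range (\<lambda>m::nat. \<lambda>_::'n. m))" by (rule finite_subset[rotated]) simp
  moreover have "inj (\<lambda>m::nat. \<lambda>_::'n. m)" by (simp add: inj_def fun_eq_iff)
  ultimately show False using finite_imageD by fastforce
qed

text \<open>Absolute convergence at the corner of the box of half-side \<rho> gives a common
  majorant for all termwise partial derivatives on the box of half-side \<open>\<rho> / 2\<close>.
  The majorant still works when one variable becomes complex, which yields the holomorphic extension
  along that coordinate line.\<close>

lemma power_series_partials:
  fixes c :: "('n::finite \<Rightarrow> nat) \<Rightarrow> real" and f :: "real^'n \<Rightarrow> real"
  defines "B \<equiv> \<lambda>a \<rho>. box (a - vec \<rho>) (a + vec \<rho>)"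
  assumes \<rho>: "\<rho> > 0"
    and sum: "(\<lambda>\<alpha>. (\<Prod>i\<in>UNIV. \<rho> ^ \<alpha> i) * \<bar>c \<alpha>\<bar>) summable_on UNIV"
    and f: "\<And>x. x \<in> B a (\<rho> / 2) \<Longrightarrow> ((\<lambda>\<alpha>. (\<Prod>i\<in>UNIV. (x $ i - a $ i) ^ \<alpha> i) * c \<alpha>) has_sum f x) UNIV"
  obtains D :: "'n \<Rightarrow> real^'n \<Rightarrow> real" where
    "\<And>x. x \<in> B a (\<rho> / 2) \<Longrightarrow> (f has_derivative (\<lambda>h. \<Sum>j\<in>UNIV. D j x * h $ j)) (at x)"
    "\<And>j. continuous_on (B a (\<rho> / 2)) (D j)"
    "\<And>j k x. x \<in> B a (\<rho> / 2) \<Longrightarrow>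
       holo_ext (ball (of_real (a $ k)) (\<rho> / 2)) (\<lambda>t. D j (x + (t - x $ k) *\<^sub>R axis k 1))"
proof -
  define S where "S = B a (\<rho> / 2)"
  have S: "open S" "convex S" "a \<in> S"
    using \<rho> by (auto simp: S_def B_def open_box convex_box mem_box_cart)
  have S_bound: "norm (x $ i - a $ i) \<le> \<rho> / 2" if "x \<in> S" for x i
    using that by (auto simp: S_def B_def mem_box_cart abs_if algebra_simps dest: spec[of _ i])
  \<comment> \<open>Any enumeration of the multi-indices turns the unordered sums into ordinary
    series with the same value, as needed for the M-test and for termwise differentiation.\<close>
  define e where "e = from_nat_into (UNIV :: ('n \<Rightarrow> nat) set)"
  have e: "bij_betw e UNIV UNIV"
    unfolding e_def by (rule bij_betw_from_nat_into) (auto simp: infinite_multi_indices)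
  define m where "m n = 2 / \<rho> * ((\<Prod>i\<in>UNIV. \<rho> ^ e n i) * \<bar>c (e n)\<bar>)" for n
  have "(\<lambda>n. (\<Prod>i\<in>UNIV. \<rho> ^ e n i) * \<bar>c (e n)\<bar>) summable_on UNIV"
    using summable_on_reindex_bij_betw[OF e, of "\<lambda>\<alpha>. (\<Prod>i\<in>UNIV. \<rho> ^ \<alpha> i) * \<bar>c \<alpha>\<bar>"] sum by simp
  then have m: "summable m"
    unfolding m_def by (intro summable_mult summable_on_imp_summable)
  have bound: "norm (of_real (c (e n)) * partial_monomial j (e n) w) \<le> m n"
    if "\<And>i. norm (w i) \<le> \<rho> / 2" for n j and w :: "'n \<Rightarrow> 'a::real_normed_field"
  proof -
    have "norm (of_real (c (e n)) * partial_monomial j (e n) w) \<le> \<bar>c (e n)\<bar> * (2 / \<rho> * (\<Prod>i\<in>UNIV. \<rho> ^ e n i))"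
      unfolding norm_mult by (intro mult_mono norm_partial_monomial_le \<rho> that) auto
    then show ?thesis by (simp add: m_def mult_ac)
  qed
  define T where "T j n x = c (e n) * partial_monomial j (e n) (\<lambda>i. x $ i - a $ i)" for j n and x :: "real^'n"
  define D where "D j x = (\<Sum>n. T j n x)" for j x
  have T_bound: "norm (T j n x) \<le> m n" if "x \<in> S" for j n x
    using bound[of "\<lambda>i. x $ i - a $ i" n j] S_bound[OF that] by (simp add: T_def)
  have unif: "uniform_limit S (\<lambda>n x. \<Sum>i<n. T j i x) (D j) sequentially" for j
    unfolding D_def using T_bound m by (rule Weierstrass_m_test)
  show thesis
  proof (rule that[of D]; (fold S_def)?)
    fix j
    show "continuous_on S (D j)"
      by (rule uniform_limit_theorem[OF _ unif])
        (auto simp: T_def intro!: always_eventually continuous_intros continuous_partial_monomial)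
  next
    have "\<exists>g. \<forall>x\<in>S. (\<lambda>n. c (e n) * (\<Prod>i\<in>UNIV. (x $ i - a $ i) ^ e n i)) sums g x \<and>
        (g has_derivative (\<lambda>h. \<Sum>j\<in>UNIV. D j x * h $ j)) (at x within S)"
    proof (rule has_derivative_series[where f' = "\<lambda>n x h. c (e n) * (\<Sum>j\<in>UNIV. partial_monomial j (e n) (\<lambda>i. x $ i - a $ i) * h $ j)"])
      show "((\<lambda>x. c (e n) * (\<Prod>i\<in>UNIV. (x $ i - a $ i) ^ e n i)) has_derivative
          (\<lambda>h. c (e n) * (\<Sum>j\<in>UNIV. partial_monomial j (e n) (\<lambda>i. x $ i - a $ i) * h $ j))) (at x within S)" for n x
        by (intro has_derivative_mult_right has_derivative_monomial)
    next
      fix \<epsilon> :: real assume "\<epsilon> > 0"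
      \<comment> \<open>The errors of the \<open>CARD('n)\<close> partial derivatives add up, so
        each gets an equal share of \<epsilon>.\<close>
      then have \<epsilon>': "\<epsilon> / CARD('n) > 0" by simp
      have "\<forall>\<^sub>F n in sequentially. \<forall>j\<in>UNIV. \<forall>x\<in>S. dist (\<Sum>i<n. T j i x) (D j x) < \<epsilon> / CARD('n)"
        using unif \<epsilon>' by (intro eventually_ball_finite) (auto simp: uniform_limit_iff)
      then show "\<forall>\<^sub>F n in sequentially. \<forall>x\<in>S. \<forall>h. norm ((\<Sum>i<n. c (e i) *
          (\<Sum>j\<in>UNIV. partial_monomial j (e i) (\<lambda>i. x $ i - a $ i) * h $ j)) - (\<Sum>j\<in>UNIV. D j x * h $ j)) \<le> \<epsilon> * norm h"
      proof (rule eventually_mono, intro ballI allI)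
        fix n x and h :: "real^'n"
        assume n: "\<forall>j\<in>UNIV. \<forall>x\<in>S. dist (\<Sum>i<n. T j i x) (D j x) < \<epsilon> / CARD('n)" and x: "x \<in> S"
        have "(\<Sum>i<n. c (e i) * (\<Sum>j\<in>UNIV. partial_monomial j (e i) (\<lambda>i. x $ i - a $ i) * h $ j))
          = (\<Sum>i<n. \<Sum>j\<in>UNIV. T j i x * h $ j)"
          by (simp add: T_def sum_distrib_left mult_ac)
        also have "\<dots> = (\<Sum>j\<in>UNIV. \<Sum>i<n. T j i x * h $ j)"
          by (rule sum.swap)
        finally have "norm ((\<Sum>i<n. c (e i) * (\<Sum>j\<in>UNIV. partial_monomial j (e i) (\<lambda>i. x $ i - a $ i) * h $ j))
            - (\<Sum>j\<in>UNIV. D j x * h $ j)) = norm (\<Sum>j\<in>UNIV. ((\<Sum>i<n. T j i x) - D j x) * h $ j)"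
          by (simp add: sum_subtractf left_diff_distrib sum_distrib_right)
        also have "\<dots> \<le> (\<Sum>j\<in>(UNIV::'n set). \<epsilon> / CARD('n) * norm h)"
        proof (rule sum_norm_le)
          fix j
          have "norm ((\<Sum>i<n. T j i x) - D j x) \<le> \<epsilon> / CARD('n)"
            using n x by (auto simp: dist_norm intro: less_imp_le)
          then show "norm (((\<Sum>i<n. T j i x) - D j x) * h $ j) \<le> \<epsilon> / CARD('n) * norm h"
            unfolding norm_mult using component_le_norm_cart[of h j] \<epsilon>' by (intro mult_mono) auto
        qed
        also have "\<dots> = \<epsilon> * norm h" by simp
        finally show "norm ((\<Sum>i<n. c (e i) * (\<Sum>j\<in>UNIV. partial_monomial j (e i) (\<lambda>i. x $ i - a $ i) * h $ j))
            - (\<Sum>j\<in>UNIV. D j x * h $ j)) \<le> \<epsilon> * norm h" .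
      qed
    next
      \<comment> \<open>Termwise differentiation asks for convergence at one point; the centre is
        taken.\<close>
      show "(\<lambda>n. c (e n) * (\<Prod>i\<in>UNIV. (a $ i - a $ i) ^ e n i)) sums f a"
        using has_sum_imp_sums[OF has_sum_reindex_bij_betw[OF e, THEN iffD2, OF f[of a]]] S(3)
        by (simp add: S_def mult_ac)
    qed (use S in auto)
    then obtain g where g: "\<And>x. x \<in> S \<Longrightarrow> (\<lambda>n. c (e n) * (\<Prod>i\<in>UNIV. (x $ i - a $ i) ^ e n i)) sums g x"
        "\<And>x. x \<in> S \<Longrightarrow> (g has_derivative (\<lambda>h. \<Sum>j\<in>UNIV. D j x * h $ j)) (at x within S)"
      by blast
    have gf: "g x = f x" if "x \<in> S" for x
    proof (rule sums_unique2[OF g(1)[OF that]])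
      show "(\<lambda>n. c (e n) * (\<Prod>i\<in>UNIV. (x $ i - a $ i) ^ e n i)) sums f x"
        using has_sum_imp_sums[OF has_sum_reindex_bij_betw[OF e, THEN iffD2, OF f[of x]]] that
        by (simp add: S_def mult_ac)
    qed
    fix x assume x: "x \<in> S"
    have "(g has_derivative (\<lambda>h. \<Sum>j\<in>UNIV. D j x * h $ j)) (at x)"
      using g(2)[OF x] at_within_open[OF x S(1)] by simp
    then show "(f has_derivative (\<lambda>h. \<Sum>j\<in>UNIV. D j x * h $ j)) (at x)"
      by (rule has_derivative_transform_within_open[OF _ S(1) x]) (rule gf)
  next
    fix j k x assume x: "x \<in> S"
    \<comment> \<open>Only the \<open>k\<close>-th variable becomes complex; the others stay at
      their values in \<open>x\<close>. The series \<phi> in \<open>z\<close> extends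
      \<open>D j\<close> along the line.\<close>
    define w where "w z i = (if i = k then z - of_real (a $ k) else of_real (x $ i - a $ i))" for z :: complex and i
    define R where "R = ball (of_real (a $ k) :: complex) (\<rho> / 2)"
    define \<phi> where "\<phi> z = (\<Sum>n. of_real (c (e n)) * partial_monomial j (e n) (w z))" for z
    have w_bound: "norm (w z i) \<le> \<rho> / 2" if "z \<in> R" for z i
      using that S_bound[OF x, of i]
      by (cases "i = k") (simp_all add: w_def R_def dist_norm norm_minus_commute del: of_real_diff)
    have unif: "uniform_limit R (\<lambda>n z. \<Sum>i<n. of_real (c (e i)) * partial_monomial j (e i) (w z)) \<phi> sequentially"
      unfolding \<phi>_def
    proof (rule Weierstrass_m_test[OF _ m])
      show "norm (of_real (c (e n)) * partial_monomial j (e n) (w z)) \<le> m n" if "z \<in> R" for n z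
        by (rule bound, rule w_bound, rule that)
    qed
    have "\<phi> holomorphic_on R"
    proof (rule holomorphic_uniform_sequence[of R "\<lambda>n z. \<Sum>i<n. of_real (c (e i)) * partial_monomial j (e i) (w z)"])
      show "open R" by (simp add: R_def)
      show "(\<lambda>z. \<Sum>i<n. of_real (c (e i)) * partial_monomial j (e i) (w z)) holomorphic_on R" for n
        unfolding w_def by (intro holomorphic_intros holomorphic_partial_monomial)
      fix z assume "z \<in> R"
      then obtain d where "d > 0" "cball z d \<subseteq> R"
        using \<open>open R\<close> open_contains_cball by blast
      then show "\<exists>d>0. cball z d \<subseteq> R \<and> uniform_limit (cball z d)
          (\<lambda>n z. \<Sum>i<n. of_real (c (e i)) * partial_monomial j (e i) (w z)) \<phi> sequentially"
        using uniform_limit_on_subset[OF unif] by blast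
    qed
    \<comment> \<open>A real point of the disc moves \<open>x\<close> to a point \<open>y\<close>
      still in \<open>S\<close>, where the real series converges and agrees term by term with the
      complex one.\<close>
    moreover have "\<phi> (of_real t) = of_real (D j (x + (t - x $ k) *\<^sub>R axis k 1))" if "of_real t \<in> R" for t
    proof -
      define y where "y = x + (t - x $ k) *\<^sub>R axis k 1"
      have y: "y $ i = (if i = k then t else x $ i)" for i
        by (simp add: y_def axis_def)
      have "norm (of_real (a $ k) - of_real t :: complex) < \<rho> / 2"
        using that by (simp add: R_def dist_norm)
      then have "\<bar>a $ k - t\<bar> < \<rho> / 2"
        by (simp flip: of_real_diff)
      then have "a $ k - \<rho> / 2 < t" "t < a $ k + \<rho> / 2"
        unfolding abs_less_iff by linarith+
      then have "y \<in> S"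
        using x by (simp add: S_def B_def mem_box_cart y)
      then have "summable (\<lambda>n. T j n y)"
        by (intro summable_comparison_test'[OF m T_bound])
      moreover have "w (of_real t) = (\<lambda>i. of_real (y $ i - a $ i))"
        by (auto simp: w_def y fun_eq_iff)
      then have "of_real (c (e n)) * partial_monomial j (e n) (w (of_real t)) = of_real (T j n y)" for n
        by (simp add: T_def partial_monomial_of_real del: of_real_diff)
      ultimately show ?thesis
        by (simp add: \<phi>_def D_def suminf_of_real flip: y_def)
    qed
    ultimately show "holo_ext (ball (of_real (a $ k)) (\<rho> / 2)) (\<lambda>t. D j (x + (t - x $ k) *\<^sub>R axis k 1))"
      unfolding R_def by (rule holo_extI)
  qed
qed

section \<open>From scalar components to Jacobian matrices\<close>

lemma jacobian_eqI:
  fixes F :: "real^'n \<Rightarrow> real^'m"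
  assumes "(F has_derivative (*v) M) (at x)"
  shows "jacobian F (at x) = M"
  by (simp add: jacobian_def frechet_derivative_at[OF assms, symmetric])

lemma real_analytic_jacobian:
  fixes F :: "real^'n \<Rightarrow> real^'m"
  assumes F: "F real_analytic_on U" and p: "p \<in> U"
  obtains \<rho> where "\<rho> > 0" "box (p - vec \<rho>) (p + vec \<rho>) \<subseteq> U"
    "\<And>x. x \<in> box (p - vec \<rho>) (p + vec \<rho>) \<Longrightarrow> F differentiable (at x)"
    "\<And>i j. continuous_on (box (p - vec \<rho>) (p + vec \<rho>)) (\<lambda>x. jacobian F (at x) $ i $ j)"
    "\<And>x i j k. x \<in> box (p - vec \<rho>) (p + vec \<rho>) \<Longrightarrow>
       holo_ext (ball (of_real (p $ k)) \<rho>)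
         (\<lambda>t. jacobian F (at (x + (t - x $ k) *\<^sub>R axis k 1)) $ i $ j)"
proof -
  obtain r c where r: "r > 0" "ball p r \<subseteq> U"
    and c: "\<And>x. x \<in> ball p r \<Longrightarrow>
      ((\<lambda>\<alpha>. (\<Prod>i\<in>UNIV. (x $ i - p $ i) ^ \<alpha> i) *\<^sub>R c \<alpha>) has_sum F x) UNIV"
    using F p unfolding real_analytic_on_def by blast
  \<comment> \<open>By the bound of the norm through the sum of the coordinates, the closed box of
    half-side \<rho>, corner included, lies within distance \<open>r / 2\<close> of
    \<open>p\<close>.\<close>
  define \<rho> where "\<rho> = r / (2 * CARD('n))"
  have \<rho>: "\<rho> > 0" using r(1) by (simp add: \<rho>_def)
  define S where "S = box (p - vec (\<rho> / 2)) (p + vec (\<rho> / 2))"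
  have in_ball: "x \<in> ball p r" if "\<And>i. \<bar>x $ i - p $ i\<bar> \<le> \<rho>" for x
  proof -
    have "norm (x - p) \<le> (\<Sum>i\<in>UNIV. \<bar>(x - p) $ i\<bar>)" by (rule norm_le_l1_cart)
    also have "\<dots> \<le> (\<Sum>i\<in>(UNIV::'n set). \<rho>)" using that by (intro sum_mono) simp
    also have "\<dots> = r / 2" by (simp add: \<rho>_def)
    finally show ?thesis using r(1) by (simp add: dist_norm norm_minus_commute)
  qed
  have S_ball: "S \<subseteq> ball p r"
  proof
    fix x assume "x \<in> S"
    then have "p $ i - \<rho> / 2 < x $ i \<and> x $ i < p $ i + \<rho> / 2" for i
      by (simp add: S_def mem_box_cart)
    then have "\<bar>x $ i - p $ i\<bar> \<le> \<rho>" for i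
      using \<rho> by (smt (verit) field_sum_of_halves)
    then show "x \<in> ball p r" by (rule in_ball)
  qed
  have comp: "((\<lambda>\<alpha>. (\<Prod>j\<in>UNIV. (x $ j - p $ j) ^ \<alpha> j) * c \<alpha> $ i) has_sum F x $ i) UNIV"
    if "x \<in> ball p r" for x i
    using has_sum_bounded_linear[OF bounded_linear_vec_nth c[OF that], of i] by simp
  have "\<exists>D :: 'n \<Rightarrow> real^'n \<Rightarrow> real.
      (\<forall>x\<in>S. ((\<lambda>x. F x $ i) has_derivative (\<lambda>h. \<Sum>j\<in>UNIV. D j x * h $ j)) (at x)) \<and>
      (\<forall>j. continuous_on S (D j)) \<and>
      (\<forall>j k. \<forall>x\<in>S. holo_ext (ball (of_real (p $ k)) (\<rho> / 2)) (\<lambda>t. D j (x + (t - x $ k) *\<^sub>R axis k 1)))" for i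
  proof -
    \<comment> \<open>Evaluating the expansion at this corner gives a summable real family, hence an
      absolutely summable one: the hypothesis \<open>sum\<close> of
      \<open>power_series_partials\<close>.\<close>
    have "p + vec \<rho> \<in> ball p r" using \<rho> by (intro in_ball) simp
    from comp[OF this] have "(\<lambda>\<alpha>. (\<Prod>j\<in>(UNIV::'n set). \<rho> ^ \<alpha> j) * c \<alpha> $ i) summable_on UNIV"
      by (auto simp: summable_on_def)
    then have "(\<lambda>\<alpha>. norm ((\<Prod>j\<in>(UNIV::'n set). \<rho> ^ \<alpha> j) * c \<alpha> $ i)) summable_on UNIV"
      by (rule summable_on_iff_abs_summable_on_real[THEN iffD1])
    then have sum: "(\<lambda>\<alpha>. (\<Prod>j\<in>(UNIV::'n set). \<rho> ^ \<alpha> j) * \<bar>c \<alpha> $ i\<bar>) summable_on UNIV"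
      using \<rho> by (simp add: abs_mult abs_prod power_abs)
    show ?thesis
      by (rule power_series_partials[OF \<rho> sum, where a = p and f = "\<lambda>x. F x $ i"])
        ((use comp S_ball in \<open>auto simp: S_def\<close>)[1], unfold S_def, blast)
  qed
  then have "\<exists>D :: 'm \<Rightarrow> 'n \<Rightarrow> real^'n \<Rightarrow> real. \<forall>i.
      (\<forall>x\<in>S. ((\<lambda>x. F x $ i) has_derivative (\<lambda>h. \<Sum>j\<in>UNIV. D i j x * h $ j)) (at x)) \<and>
      (\<forall>j. continuous_on S (D i j)) \<and>
      (\<forall>j k. \<forall>x\<in>S. holo_ext (ball (of_real (p $ k)) (\<rho> / 2)) (\<lambda>t. D i j (x + (t - x $ k) *\<^sub>R axis k 1)))"
    by (intro choice allI)
  then obtain D :: "'m \<Rightarrow> 'n \<Rightarrow> real^'n \<Rightarrow> real" where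
    D: "\<And>i x. x \<in> S \<Longrightarrow> ((\<lambda>x. F x $ i) has_derivative (\<lambda>h. \<Sum>j\<in>UNIV. D i j x * h $ j)) (at x)"
    and D_cont: "\<And>i j. continuous_on S (D i j)"
    and D_holo: "\<And>i j k x. x \<in> S \<Longrightarrow>
      holo_ext (ball (of_real (p $ k)) (\<rho> / 2)) (\<lambda>t. D i j (x + (t - x $ k) *\<^sub>R axis k 1))"
    by blast
  have der: "(F has_derivative (*v) (\<chi> i j. D i j x)) (at x)" if "x \<in> S" for x
  proof (subst has_derivative_componentwise_within, intro ballI)
    fix b :: "real^'m" assume "b \<in> Basis"
    then obtain i where b: "b = axis i 1" by (auto simp: Basis_vec_def)
    show "((\<lambda>x. F x \<bullet> b) has_derivative (\<lambda>h. ((\<chi> i j. D i j x) *v h) \<bullet> b)) (at x)"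
      using D[OF that, of i] by (simp add: b inner_axis matrix_vector_mult_def)
  qed
  have jac: "jacobian F (at x) $ i $ j = D i j x" if "x \<in> S" for x i j
    using jacobian_eqI[OF der[OF that]] by simp
  show thesis
  proof (rule that[of "\<rho> / 2"]; (fold S_def)?)
    show "\<rho> / 2 > 0" using \<rho> by simp
    show "S \<subseteq> U" using S_ball r(2) by blast
    show "F differentiable (at x)" if "x \<in> S" for x
      using der[OF that] by (auto simp: differentiable_def)
    show "continuous_on S (\<lambda>x. jacobian F (at x) $ i $ j)" for i j
      using D_cont[of i j] by (rule continuous_on_cong[THEN iffD1, rotated 2]) (simp_all add: jac)
    fix x i j k assume x: "x \<in> S"
    have "x + (t - x $ k) *\<^sub>R axis k 1 \<in> S" if "of_real t \<in> ball (of_real (p $ k) :: complex) (\<rho> / 2)" for t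
    proof -
      have "\<bar>p $ k - t\<bar> < \<rho> / 2"
        using that by (simp add: dist_norm flip: of_real_diff)
      then have "p $ k - \<rho> / 2 < t" "t < p $ k + \<rho> / 2"
        unfolding abs_less_iff by linarith+
      then show ?thesis using x by (auto simp: S_def mem_box_cart axis_def)
    qed
    then show "holo_ext (ball (of_real (p $ k)) (\<rho> / 2))
        (\<lambda>t. jacobian F (at (x + (t - x $ k) *\<^sub>R axis k 1)) $ i $ j)"
      using D_holo[OF x, of k i j] by (subst holo_ext_cong[OF jac])
  qed
qed

text \<open>The certificate of the Jacobian at \<open>x0\<close> gives a function \<open>h\<close>,
  polynomial in the entries of the Jacobian, with \<open>h x0 = 1\<close>. A drop of the rank below
  its value at \<open>x0\<close> forces \<open>h\<close> to vanish, and the zeros of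
  \<open>h\<close> are negligible by connectedness.\<close>

lemma negligible_rank_deficient:
  fixes F :: "real^'n \<Rightarrow> real^'m"
  assumes U: "open U" "connected U" and F: "F real_analytic_on U" and x0: "x0 \<in> U"
  shows "negligible {x \<in> U. rank (jacobian F (at x)) < rank (jacobian F (at x0))}"
proof -
  obtain L :: "real^'m^'n" and K :: "real^'n^'n"
    where LK: "L ** jacobian F (at x0) + K = mat 1"
      "\<And>B :: real^'n^'m. det (L ** B + K) \<noteq> 0 \<Longrightarrow> rank (jacobian F (at x0)) \<le> rank B"
    using rank_certificate by blast
  define h where "h x = det (L ** jacobian F (at x) + K)" for x
  have loc: "\<exists>\<rho>>0. box (p - vec \<rho>) (p + vec \<rho>) \<subseteq> U \<and> continuous_on (box (p - vec \<rho>) (p + vec \<rho>)) h \<and>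
      (\<forall>x\<in>box (p - vec \<rho>) (p + vec \<rho>). \<forall>k.
        holo_ext (ball (of_real (p $ k)) \<rho>) (\<lambda>t. h (x + (t - x $ k) *\<^sub>R axis k 1)))"
    if "p \<in> U" for p
  proof (rule real_analytic_jacobian[OF F that])
    fix \<rho> :: real
    assume \<rho>: "\<rho> > 0" "box (p - vec \<rho>) (p + vec \<rho>) \<subseteq> U"
      and cont: "\<And>i j. continuous_on (box (p - vec \<rho>) (p + vec \<rho>)) (\<lambda>x. jacobian F (at x) $ i $ j)"
      and holo: "\<And>x i j k. x \<in> box (p - vec \<rho>) (p + vec \<rho>) \<Longrightarrow>
        holo_ext (ball (of_real (p $ k)) \<rho>) (\<lambda>t. jacobian F (at (x + (t - x $ k) *\<^sub>R axis k 1)) $ i $ j)"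
    have "continuous_on (box (p - vec \<rho>) (p + vec \<rho>)) h"
      unfolding h_def det_def matrix_matrix_mult_def
      by (simp, intro continuous_on_sum continuous_on_prod continuous_on_mult continuous_on_add
          continuous_on_const cont)
    moreover have "holo_ext (ball (of_real (p $ k)) \<rho>) (\<lambda>t. h (x + (t - x $ k) *\<^sub>R axis k 1))"
      if "x \<in> box (p - vec \<rho>) (p + vec \<rho>)" for x k
      unfolding h_def matrix_matrix_mult_def
      by (rule holo_ext_det, simp)
        (intro holo_ext_add holo_ext_sum holo_ext_mult holo_ext_const holo that)
    ultimately show ?thesis using \<rho> by blast
  qed
  have "negligible {x \<in> U. h x = 0}"
  proof (rule negligible_zeros_connected[OF U])
    show "continuous_on U h"
      unfolding continuous_on_eq_continuous_at[OF U(1)]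
    proof
      fix p assume "p \<in> U"
      then obtain \<rho> where \<rho>: "\<rho> > 0" "continuous_on (box (p - vec \<rho>) (p + vec \<rho>)) h"
        using loc by blast
      have "p \<in> box (p - vec \<rho>) (p + vec \<rho>)"
        using \<rho>(1) by (simp add: mem_box_cart)
      then show "isCont h p"
        using \<rho>(2) continuous_on_eq_continuous_at[OF open_box] by blast
    qed
  next
    fix p assume "p \<in> U"
    then obtain \<rho> where \<rho>: "\<rho> > 0" "box (p - vec \<rho>) (p + vec \<rho>) \<subseteq> U"
      "\<forall>x\<in>box (p - vec \<rho>) (p + vec \<rho>). \<forall>k.
        holo_ext (ball (of_real (p $ k)) \<rho>) (\<lambda>t. h (x + (t - x $ k) *\<^sub>R axis k 1))"
      using loc by blast
    let ?a = "p - vec \<rho>" and ?b = "p + vec \<rho>"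
    have "countable {t \<in> {?a \<bullet> e<..<?b \<bullet> e}. h (y + (t - y \<bullet> e) *\<^sub>R e) = 0} \<or>
        (\<forall>t\<in>{?a \<bullet> e<..<?b \<bullet> e}. h (y + (t - y \<bullet> e) *\<^sub>R e) = 0)"
      if y: "y \<in> box ?a ?b" and "e \<in> Basis" for y e
    proof -
      from \<open>e \<in> Basis\<close> obtain k where e: "e = axis k 1" by (auto simp: Basis_vec_def)
      let ?S = "ball (of_real (p $ k) :: complex) \<rho>"
      have "holo_ext ?S (\<lambda>t. h (y + (t - y $ k) *\<^sub>R axis k 1))"
        using \<rho>(3) y by blast
      then have "countable {t. of_real t \<in> ?S \<and> h (y + (t - y $ k) *\<^sub>R axis k 1) = 0} \<or>
          (\<forall>t. of_real t \<in> ?S \<longrightarrow> h (y + (t - y $ k) *\<^sub>R axis k 1) = 0)"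
        by (rule holo_ext_zeros) auto
      \<comment> \<open>The real points of the disc form exactly the side of the box in direction
        \<open>e\<close>.\<close>
      moreover have "of_real t \<in> ?S \<longleftrightarrow> t \<in> {?a \<bullet> e<..<?b \<bullet> e}" for t
      proof -
        have "dist (of_real (p $ k) :: complex) (of_real t) = \<bar>p $ k - t\<bar>"
          by (simp add: dist_norm flip: of_real_diff)
        then show ?thesis by (auto simp: e inner_axis)
      qed
      ultimately show ?thesis by (simp add: e inner_axis Ball_def)
    qed
    moreover have "p \<in> box ?a ?b"
      using \<rho>(1) by (simp add: mem_box_cart)
    ultimately show "\<exists>a b. p \<in> box a b \<and> box a b \<subseteq> U \<and>
      (\<forall>y\<in>box a b. \<forall>e\<in>Basis.
        countable {t \<in> {a \<bullet> e<..<b \<bullet> e}. h (y + (t - y \<bullet> e) *\<^sub>R e) = 0} \<or>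
        (\<forall>t\<in>{a \<bullet> e<..<b \<bullet> e}. h (y + (t - y \<bullet> e) *\<^sub>R e) = 0))"
      using \<rho>(2) by blast
  next
    show "x0 \<in> U" by fact
    show "h x0 \<noteq> 0" by (simp add: h_def LK(1))
  qed
  then show ?thesis
    by (rule negligible_subset) (use LK(2) in \<open>force simp: h_def\<close>)
qed

section \<open>Almost every element of a space of functions\<close>

lemma rank_scaleR_le:
  fixes M :: "real^'n^'m"
  assumes "k \<noteq> 0"
  shows "rank M \<le> rank (k *\<^sub>R M)"
proof -
  have "M = ((1 / k) *\<^sub>R mat 1) ** (k *\<^sub>R M)"
    using assms by (simp add: matrix_scalar_ac flip: scalar_matrix_assoc)
  then show ?thesis by (metis rank_mul_le_right)
qed

section \<open>Linear matrix-valued maps, abstracting the Jacobian at one fixed point\<close>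

context
  fixes V :: "'v::real_vector set" and J :: "'v \<Rightarrow> real^'n^'m"
  assumes V: "subspace V"
    and J_add: "\<And>f g. f \<in> V \<Longrightarrow> g \<in> V \<Longrightarrow> J (f + g) = J f + J g"
    and J_scale: "\<And>k f. f \<in> V \<Longrightarrow> J (k *\<^sub>R f) = k *\<^sub>R J f"
begin

text \<open>Linearity of \<open>J\<close> is available only inside \<open>V\<close>, as Jacobians
  add only for differentiable maps; membership and the formula are therefore proved in one
  induction.\<close>

lemma J_plane:
  assumes "finite B" "B \<subseteq> V" "P \<in> V"
  shows "P + (\<Sum>b\<in>B. c b *\<^sub>R b) \<in> V"
    and "J (P + (\<Sum>b\<in>B. c b *\<^sub>R b)) = J P + (\<Sum>b\<in>B. c b *\<^sub>R J b)"
proof -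
  have J0: "J 0 = 0" using J_scale[OF subspace_0[OF V], of 0] by simp
  have "(\<Sum>b\<in>B. c b *\<^sub>R b) \<in> V \<and> J (\<Sum>b\<in>B. c b *\<^sub>R b) = (\<Sum>b\<in>B. c b *\<^sub>R J b)"
    using assms(1,2)
    by (induction B rule: finite_induct)
      (auto simp: J0 J_add J_scale subspace_0[OF V] subspace_add[OF V] subspace_scale[OF V])
  then show "P + (\<Sum>b\<in>B. c b *\<^sub>R b) \<in> V"
    and "J (P + (\<Sum>b\<in>B. c b *\<^sub>R b)) = J P + (\<Sum>b\<in>B. c b *\<^sub>R J b)"
    using assms(3) by (auto simp: J_add subspace_add[OF V])
qed

text \<open>One point of the plane with large rank suffices: its certificate determinant is a
  polynomial in the coordinates, nonzero at that point and hence almost everywhere. As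
  \<open>F0\<close> lies in \<open>span B\<close>, such a point is found far out in the direction
  \<open>F0\<close>.\<close>

lemma AE_plane_rank_ge:
  assumes B: "finite B" "independent B" "B \<subseteq> V" and P: "P \<in> V" and F0: "F0 \<in> span B"
    and max: "\<And>f. f \<in> V \<Longrightarrow> rank (J f) \<le> rank (J F0)"
  shows "AE H in plane_lebesgue 0 B. rank (J F0) \<le> rank (J (H + P))"
proof -
  define A where "A c = J P + (\<Sum>b\<in>B. c b *\<^sub>R J b)" for c
  have A: "A c = J ((\<Sum>b\<in>B. c b *\<^sub>R b) + P)" for c
    using J_plane(2)[OF B(1,3) P, of c] by (simp add: A_def add.commute)
  obtain a where a: "F0 = (\<Sum>b\<in>B. a b *\<^sub>R b)"
    using F0 span_finite[OF B(1)] by auto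
  have F0V: "F0 \<in> V" using F0 span_minimal[OF B(3) V] by blast
  \<comment> \<open>The rank of \<open>P + F0 / s\<close> is that of \<open>F0 + s P\<close>, a small perturbation of \<open>F0\<close>.\<close>
  have "((\<lambda>s. J F0 + s *\<^sub>R J P) \<longlongrightarrow> J F0 + 0 *\<^sub>R J P) (at_right 0)"
    by (intro tendsto_intros)
  then have "\<forall>\<^sub>F s in at_right 0. J F0 + s *\<^sub>R J P \<in> {M. rank (J F0) \<le> rank M}"
    by (rule topological_tendstoD) (auto simp: open_rank_ge)
  then have "\<forall>\<^sub>F s in at_right 0. rank (J F0) \<le> rank (J F0 + s *\<^sub>R J P) \<and> s > 0"
    by (intro eventually_conj) (auto simp: eventually_at_right_less)
  then obtain s :: real where s: "rank (J F0) \<le> rank (J F0 + s *\<^sub>R J P)" "s > 0"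
    using eventually_happens[of _ "at_right (0::real)"] by (auto simp: trivial_limit_at_right_real)
  \<comment> \<open>The coordinates of \<open>F0 / s\<close>; they locate the point of large rank in
    the plane.\<close>
  define a' where "a' b = (1 / s) * a b" for b
  have "A a' = J ((1 / s) *\<^sub>R F0 + P)"
    by (simp add: A a a'_def scaleR_sum_right)
  also have "\<dots> = (1 / s) *\<^sub>R (J F0 + s *\<^sub>R J P)"
    using s(2) F0V P by (simp add: J_add J_scale subspace_scale[OF V] scaleR_add_right)
  finally have rank_a': "rank (J F0) \<le> rank (A a')"
    using s rank_scaleR_le[of "1 / s" "J F0 + s *\<^sub>R J P"] by simp
  obtain L :: "real^'m^'n" and K :: "real^'n^'n"
    where LK: "L ** A a' + K = mat 1"
      "\<And>M :: real^'n^'m. det (L ** M + K) \<noteq> 0 \<Longrightarrow> rank (A a') \<le> rank M"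
    using rank_certificate by blast
  define f where "f c = det (L ** A c + K)" for c
  have A_comp: "A c $ i $ j = J P $ i $ j + (\<Sum>b\<in>B. c b * J b $ i $ j)" for c i j
    by (simp add: A_def)
  have f_comp: "f c = (\<Sum>p\<in>{p. p permutes UNIV}. of_int (sign p) *
      (\<Prod>i\<in>UNIV. (\<Sum>k\<in>UNIV. L $ i $ k * A c $ k $ p i) + K $ i $ p i))" for c
    by (simp add: f_def det_def matrix_matrix_mult_def)
  have "AE c in PiM B (\<lambda>_. lborel). c \<in> PiE B (\<lambda>_. UNIV) \<longrightarrow> f c \<noteq> 0"
  proof (rule AE_PiM_nonzero[OF B(1)])
    have "f \<in> borel_measurable (PiM B (\<lambda>_. lborel))"
      unfolding f_comp A_comp by measurable
    then have "{c \<in> space (PiM B (\<lambda>_. lborel)). f c = 0} \<in> sets (PiM B (\<lambda>_. lborel))"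
      by measurable
    then show "{c \<in> PiE B (\<lambda>_. UNIV). f c = 0} \<in> sets (PiM B (\<lambda>_. lborel))"
      by (simp add: space_PiM)
  next
    fix c i assume "i \<in> B"
    \<comment> \<open>Each coordinate is constant or equal to \<open>t\<close>, so \<open>f\<close>
      along the line is a polynomial in \<open>t\<close> and extends to the whole complex
      plane.\<close>
    have "holo_ext UNIV (\<lambda>t. (c(i := t)) b)" for b
      by (cases "b = i") auto
    then have "holo_ext UNIV (\<lambda>t. f (c(i := t)))"
      unfolding f_comp A_comp
      by (intro holo_ext_add holo_ext_sum holo_ext_mult holo_ext_prod holo_ext_const)
    then show "countable {t \<in> UNIV. f (c(i := t)) = 0} \<or> (\<forall>t\<in>UNIV. f (c(i := t)) = 0)"
      using holo_ext_zeros[OF _ open_UNIV connected_UNIV] by fastforce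
  next
    show "restrict a' B \<in> PiE B (\<lambda>_. UNIV)" by simp
    have "A (restrict a' B) = A a'" by (simp add: A_def)
    then show "f (restrict a' B) \<noteq> 0" by (simp add: f_def LK(1))
  qed
  moreover have "AE c in PiM B (\<lambda>_. lborel :: real measure). c \<in> PiE B (\<lambda>_. UNIV)"
    by (rule AE_I2) (simp add: space_PiM)
  ultimately have "AE c in PiM B (\<lambda>_. lborel). rank (J F0) \<le> rank (A c)"
  proof eventually_elim
    case (elim c)
    then have "rank (A a') \<le> rank (A c)" by (intro LK(2)) (simp add: f_def)
    with rank_a' show ?case by (rule order_trans)
  qed
  then have "AE c in completion (PiM B (\<lambda>_. lborel)). rank (J F0) \<le> rank (A c)"
    by (rule AE_completion)
  then show ?thesis
    unfolding plane_lebesgue_def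
    by (subst AE_embed_measure'[OF inj_on_plane_coordinates[OF B(1,2)]]) (simp add: A)
qed

text \<open>In coordinates of a plane, \<open>J\<close> is a measurable affine map into matrices and
  the rank condition is the preimage of an open set.\<close>

lemma plane_measurable_rank_ge: "plane_measurable V {f \<in> V. r \<le> rank (J f)}"
  unfolding plane_measurable_def
proof (intro conjI allI impI)
  fix P :: 'v and B :: "'v set"
  assume "finite B \<and> independent B \<and> plane P B \<subseteq> V"
  then have B: "finite B" "independent B" and PB: "plane P B \<subseteq> V" by auto
  \<comment> \<open>Only the plane is known to lie in \<open>V\<close>; its base point is recovered
    from the zero vector, and its directions as differences with that point.\<close>
  have P: "P \<in> V" using PB span_zero by (force simp: plane_def)
  have BV: "B \<subseteq> V"
  proof
    fix b assume "b \<in> B"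
    then have "P + b \<in> V" using PB span_base by (force simp: plane_def)
    then show "b \<in> V" using subspace_diff[OF V _ P] by force
  qed
  let ?M = "PiM B (\<lambda>_. lborel :: real measure)"
  define \<phi> where "\<phi> c = P + (\<Sum>b\<in>B. c b *\<^sub>R b)" for c
  have "(\<lambda>c. J P + (\<Sum>b\<in>B. c b *\<^sub>R J b)) \<in> borel_measurable ?M"
    by measurable
  then have "{c \<in> space ?M. J P + (\<Sum>b\<in>B. c b *\<^sub>R J b) \<in> {M. r \<le> rank M}} \<in> sets ?M"
    by (rule measurable_sets_Collect) (simp add: open_rank_ge borel_open)
  then have "{c \<in> space ?M. r \<le> rank (J (\<phi> c))} \<in> sets (completion ?M)"
    by (simp add: \<phi>_def J_plane(2)[OF B(1) BV P] sets_completionI_sets)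
  then have "\<phi> ` {c \<in> space ?M. r \<le> rank (J (\<phi> c))} \<in> sets (plane_lebesgue P B)"
    unfolding plane_lebesgue_def \<phi>_def by (rule in_sets_embed_measure)
  moreover have "plane P B = \<phi> ` space ?M"
    using space_plane_lebesgue[OF B(1), of P]
    by (simp add: plane_lebesgue_def space_embed_measure \<phi>_def)
  then have "plane P B \<inter> {f \<in> V. r \<le> rank (J f)} = \<phi> ` {c \<in> space ?M. r \<le> rank (J (\<phi> c))}"
    using PB by auto
  ultimately show "plane P B \<inter> {f \<in> V. r \<le> rank (J f)} \<in> sets (plane_lebesgue P B)"
    by simp
qed auto

text \<open>In finite dimension the plane is \<open>V\<close> itself with base point 0. Otherwise
  the line spanned by \<open>F0\<close> serves as the probe space for prevalence.\<close>

lemma almost_every_rank_ge: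
  assumes F0: "F0 \<in> V" and max: "\<And>f. f \<in> V \<Longrightarrow> rank (J f) \<le> rank (J F0)"
    and Q: "\<And>f. f \<in> V \<Longrightarrow> rank (J F0) \<le> rank (J f) \<Longrightarrow> Q f"
  shows "almost_every V Q"
proof (cases "finite_dimensional V")
  case True
  have "AE F in plane_lebesgue 0 B. Q F" if B: "finite B" "independent B" "span B = V" for B
  proof -
    have "B \<subseteq> V" using B(3) span_superset by blast
    moreover have "F0 \<in> span B" using F0 B(3) by simp
    ultimately have "AE H in plane_lebesgue 0 B. rank (J F0) \<le> rank (J (H + 0))"
      using max by (intro AE_plane_rank_ge B subspace_0[OF V])
    then have "AE H in plane_lebesgue 0 B. rank (J F0) \<le> rank (J H)" by simp
    moreover have "AE H in plane_lebesgue 0 B. H \<in> V"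
      by (rule AE_I2) (simp add: space_plane_lebesgue B(1,3) plane_def)
    ultimately show ?thesis
      by eventually_elim (rule Q)
  qed
  then show ?thesis using True by (simp add: almost_every_def)
next
  case False
  define G where "G = {f \<in> V. rank (J F0) \<le> rank (J f)}"
  \<comment> \<open>A singleton of the zero vector is dependent, so for \<open>F0 = 0\<close> the
    basis is empty; its span still contains \<open>F0\<close>.\<close>
  define B where "B = (if F0 = 0 then {} else {F0})"
  have B: "finite B" "independent B" "B \<subseteq> V" "F0 \<in> span B"
    using F0 by (auto simp: B_def dependent_single independent_empty intro: span_base)
  have span: "span B \<subseteq> V" using B(3) V by (rule span_minimal)
  have "AE H in plane_lebesgue 0 B. H + P \<in> G" if P: "P \<in> V" for P
  proof -
    have "AE H in plane_lebesgue 0 B. H \<in> V"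
      by (rule AE_I2) (use span in \<open>auto simp: space_plane_lebesgue B(1) plane_def\<close>)
    moreover have "AE H in plane_lebesgue 0 B. rank (J F0) \<le> rank (J (H + P))"
      using AE_plane_rank_ge[OF B(1-3) P B(4)] max by blast
    ultimately show ?thesis
      by eventually_elim (simp add: G_def subspace_add[OF V _ P])
  qed
  then have "prevalent_in V G"
    unfolding prevalent_in_def using B span by blast
  moreover have "plane_measurable V G"
    unfolding G_def by (rule plane_measurable_rank_ge)
  ultimately show ?thesis
    using False Q by (auto simp: almost_every_def G_def)
qed

end

section \<open>Linearity of the Jacobian and the conclusion\<close>

lemma differentiable_real_analytic:
  fixes F :: "real^'n \<Rightarrow> real^'m"
  assumes "F real_analytic_on U" "x \<in> U"
  shows "F differentiable (at x)"
proof (rule real_analytic_jacobian[OF assms])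
  fix \<rho> :: real
  assume "\<rho> > 0" "\<And>y. y \<in> box (x - vec \<rho>) (x + vec \<rho>) \<Longrightarrow> F differentiable (at y)"
  then show ?thesis by (simp add: mem_box_cart)
qed

lemma jacobian_add:
  fixes F G :: "real^'n \<Rightarrow> real^'m"
  assumes "F differentiable (at x)" "G differentiable (at x)"
  shows "jacobian (F + G) (at x) = jacobian F (at x) + jacobian G (at x)"
  using has_derivative_add[OF assms[unfolded jacobian_works]]
  by (intro jacobian_eqI) (simp add: plus_fun_def matrix_vector_mult_add_rdistrib[abs_def])

lemma jacobian_scaleR:
  fixes F :: "real^'n \<Rightarrow> real^'m"
  assumes "F differentiable (at x)"
  shows "jacobian (k *\<^sub>R F) (at x) = k *\<^sub>R jacobian F (at x)"
  using has_derivative_scaleR_right[OF assms[unfolded jacobian_works], of k]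
  by (intro jacobian_eqI) (simp add: scaleR_fun_def scaleR_matrix_vector_assoc[abs_def])

text \<open>With \<open>J\<close> constantly 0 the rank condition is trivial. This settles an empty
  domain.\<close>

lemma almost_every_True:
  assumes "subspace V" "\<And>F. F \<in> V \<Longrightarrow> Q F"
  shows "almost_every V Q"
  by (rule almost_every_rank_ge[where J = "\<lambda>_. 0 :: real^1^1" and ?F0.0 = 0])
    (auto simp: assms subspace_0)

theorem mainTheorem6:
  fixes U :: "(real^'n) set" and \<F> :: "(real^'n \<Rightarrow> real^'m) set"
  assumes "open U" and "connected U"
    and "function_space_on U \<F>"
    and "\<And>F. F \<in> \<F> \<Longrightarrow> F real_analytic_on U"
  shows "ACR U \<F>"
proof (cases "U = {}")
  case True
  \<comment> \<open>Over an empty domain the condition on \<open>x\<close> is vacuous, whatever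
    value \<open>maxrank\<close> takes as a maximum of the empty set.\<close>
  have "subspace \<F>" using assms(3) by (simp add: function_space_on_def)
  then show ?thesis
    unfolding ACR_def by (rule almost_every_True) (rule AE_I2, simp add: True)
next
  case False
  have sub: "subspace \<F>" using assms(3) by (simp add: function_space_on_def)
  define R where "R = {rank (jacobian F (at x)) | F x. F \<in> \<F> \<and> x \<in> U}"
  \<comment> \<open>Ranks are bounded, so the maximum is attained, at some \<open>F0\<close> and
    \<open>x0\<close>.\<close>
  have "R \<subseteq> {..CARD('n)}"
    using rank_bound by (fastforce simp: R_def)
  then have R: "finite R" by (rule finite_subset) simp
  have "R \<noteq> {}"
    using subspace_0[OF sub] False by (auto simp: R_def)
  then have "maxrank U \<F> \<in> R"
    unfolding maxrank_def R_def[symmetric] using R by (intro Max_in)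
  then obtain F0 x0 where F0: "F0 \<in> \<F>" "x0 \<in> U" "maxrank U \<F> = rank (jacobian F0 (at x0))"
    by (auto simp: R_def)
  have max: "rank (jacobian F (at x)) \<le> maxrank U \<F>" if "F \<in> \<F>" "x \<in> U" for F x
    unfolding maxrank_def R_def[symmetric] using R that by (intro Max_ge) (auto simp: R_def)
  have diff: "F differentiable (at x0)" if "F \<in> \<F>" for F
    using differentiable_real_analytic[OF assms(4)[OF that] F0(2)] .
  show ?thesis
    unfolding ACR_def
  \<comment> \<open>Testing the rank at the single point \<open>x0\<close> is enough: if
    \<open>F\<close> attains the maximum there, its rank is below the maximum only on a negligible
    set.\<close>
  proof (rule almost_every_rank_ge[OF sub _ _ F0(1), where J = "\<lambda>F. jacobian F (at x0)"])
    fix F assume F: "F \<in> \<F>" and ge: "rank (jacobian F0 (at x0)) \<le> rank (jacobian F (at x0))"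
    have "negligible {x \<in> U. rank (jacobian F (at x)) < rank (jacobian F (at x0))}"
      by (rule negligible_rank_deficient) (use assms F F0 in auto)
    then have "AE x in lebesgue. x \<notin> {x \<in> U. rank (jacobian F (at x)) < rank (jacobian F (at x0))}"
      by (intro AE_not_in) (simp add: negligible_iff_null_sets)
    then have "AE x in lebesgue. x \<in> U \<longrightarrow> rank (jacobian F (at x)) = maxrank U \<F>"
    proof eventually_elim
      case (elim x)
      show ?case
      proof
        assume "x \<in> U"
        then show "rank (jacobian F (at x)) = maxrank U \<F>"
          using elim ge max[OF F] F0(3) by fastforce
      qed
    qed
    then show "AE x in lebesgue_on U. rank (jacobian F (at x)) = maxrank U \<F>"
      using assms(1) by (simp add: AE_restrict_space_iff)
  qed (use diff max F0 in \<open>auto simp: jacobian_add jacobian_scaleR\<close>)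
qed

end
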